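(* Let $f\in\overline{\mathrm{co}(C)}$, $f(z)=z+\sum_{k=2}^\infty a_kz^k$, and let $m,n\ge2$ be integers. Then $$|a_ma_n-a_{m+n-1}|+|a_ma_n|\le1.$$ This is equivalent to the following statement: $$|\lambda a_ma_n-a_{m+n-1}|\le\max\{1,|1-\lambda|\}\quad\text{for all }\lambda\in\mathbb{C}.$$ Equality holds in both inequalities for the function $$f(z)=\frac{z}{1-z}$$ when $|1-\lambda|\ge1$, and for the function $$f(z)=\frac{z}{1-z^{m+n-2}}$$ when $|1-\lambda|<1$.
   Context: $\mathbb{D}$ is the open unit disk in $\mathbb{C}$. $S$ is the class of all univalent (analytic and one-to-one) functions $f$ in $\mathbb{D}$ with Taylor series $f(z)=z+\sum_{n=2}^\infty a_nz^n$. $C$ is the class of convex functions in $S$, i.e. those $f\in S$ for which $f(\mathbb{D})$ is a convex set. $\mathrm{co}(C)$ is the convex hull of $C$ and $\overline{\mathrm{co}(C)}$ is its closure in the topology of uniform convergence on compact subsets of $\mathbb{D}$. (By a known result of Marx and Strohhäcker, $\overline{\mathrm{co}(C)}$ is the set of analytic $f$ in $\mathbb{D}$ with $\mathrm{Re}(f(z)/z)>1/2$ and $f(0)=f'(0)-1=0$.) *)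

theory Defs
  imports "HOL-Complex_Analysis.Complex_Analysis"
begin

text \<open>
  Analytic functions on the open unit disk are represented by total functions that are
  holomorphic on \<^term>\<open>ball 0 1 :: complex set\<close>; their values outside the disk are irrelevant
  throughout (all sets below are invariant under changing a function off the disk).
\<close>

abbreviation unit_disk :: "complex set" where
  "unit_disk \<equiv> ball 0 1"

abbreviation taylor_coeff :: "(complex \<Rightarrow> complex) \<Rightarrow> nat \<Rightarrow> complex" where
  "taylor_coeff f k \<equiv> fps_nth (fps_expansion f 0) k"

text \<open>Having a Taylor series $z + a_2 z^2 + \ldots$ amounts to $f(0) = 0$ and $f'(0) = 1$.\<close>

definition class_S :: "(complex \<Rightarrow> complex) set" where
  "class_S = {f. f holomorphic_on unit_disk \<and> inj_on f unit_disk \<and> f 0 = 0 \<and> deriv f 0 = 1}"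

definition class_C :: "(complex \<Rightarrow> complex) set" where
  "class_C = {f \<in> class_S. convex (f ` unit_disk)}"

text \<open>
  The function space is not an instance of \<^class>\<open>real_vector\<close>, so the library's \<^const>\<open>convex\<close>
  does not apply to sets of functions; this is its definition with pointwise operations.
\<close>

definition fun_convex :: "(complex \<Rightarrow> complex) set \<Rightarrow> bool" where
  "fun_convex F \<longleftrightarrow>
     (\<forall>f\<in>F. \<forall>g\<in>F. \<forall>u\<ge>0. \<forall>v\<ge>0. u + v = 1 \<longrightarrow> (\<lambda>z. u *\<^sub>R f z + v *\<^sub>R g z) \<in> F)"

lemma fun_convex_Inter: "(\<And>F. F \<in> \<F> \<Longrightarrow> fun_convex F) \<Longrightarrow> fun_convex (\<Inter>\<F>)"
  unfolding fun_convex_def by blast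

lemma fun_convex_fun_convex_hull: "fun_convex (fun_convex hull F)"
  by (rule hull_in) (simp add: fun_convex_Inter)

text \<open>The topology of uniform convergence on compact subsets, on the analytic functions on \<open>D\<close>.\<close>

definition compact_convergence :: "complex set \<Rightarrow> (complex \<Rightarrow> complex) topology" where
  "compact_convergence D = topology (\<lambda>U. U \<subseteq> {f. f holomorphic_on D} \<and>
     (\<forall>f\<in>U. \<exists>K e. compact K \<and> K \<subseteq> D \<and> e > 0 \<and>
        {g. g holomorphic_on D \<and> (\<forall>z\<in>K. dist (g z) (f z) < e)} \<subseteq> U))"

lemma openin_compact_convergence:
  "openin (compact_convergence D) U \<longleftrightarrow> U \<subseteq> {f. f holomorphic_on D} \<and>
     (\<forall>f\<in>U. \<exists>K e. compact K \<and> K \<subseteq> D \<and> e > 0 \<and>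
        {g. g holomorphic_on D \<and> (\<forall>z\<in>K. dist (g z) (f z) < e)} \<subseteq> U)"
proof -
  let ?P = "\<lambda>U f K e. compact K \<and> K \<subseteq> D \<and> (e::real) > 0 \<and>
        {g. g holomorphic_on D \<and> (\<forall>z\<in>K. dist (g z) (f z) < e)} \<subseteq> U"
  let ?L = "\<lambda>U. U \<subseteq> {f. f holomorphic_on D} \<and> (\<forall>f\<in>U. \<exists>K e. ?P U f K e)"
  have "istopology ?L"
    unfolding istopology_def
  proof (intro conjI allI impI)
    fix S T assume S: "?L S" and T: "?L T"
    show "S \<inter> T \<subseteq> {f. f holomorphic_on D}" using S by blast
    show "\<forall>f\<in>S \<inter> T. \<exists>K e. ?P (S \<inter> T) f K e"
    proof
      fix f assume f: "f \<in> S \<inter> T"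
      obtain K e where 1: "?P S f K e" using S f by blast
      obtain L d where 2: "?P T f L d" using T f by blast
      have "?P (S \<inter> T) f (K \<union> L) (min e d)"
        using 1 2 by (auto intro: compact_Un)
      then show "\<exists>K e. ?P (S \<inter> T) f K e" by blast
    qed
  next
    fix \<K> assume K: "\<forall>S\<in>\<K>. ?L S"
    show "\<Union>\<K> \<subseteq> {f. f holomorphic_on D}" using K by (intro Union_least) simp
    show "\<forall>f\<in>\<Union>\<K>. \<exists>K e. ?P (\<Union>\<K>) f K e"
    proof
      fix f assume "f \<in> \<Union>\<K>"
      then obtain S where S: "S \<in> \<K>" "f \<in> S" by blast
      have "\<forall>f\<in>S. \<exists>K e. ?P S f K e" using K S(1) by simp
      from bspec[OF this S(2)] obtain K e where 1: "?P S f K e" by (elim exE)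
      have "S \<subseteq> \<Union>\<K>" using S(1) by (rule Union_upper)
      with 1 have "?P (\<Union>\<K>) f K e" by (elim conjE) (intro conjI, assumption+, erule (1) subset_trans)
      then show "\<exists>K e. ?P (\<Union>\<K>) f K e" by blast
    qed
  qed
  then show ?thesis
    unfolding compact_convergence_def by (simp add: topology_inverse')
qed

lemma topspace_compact_convergence [simp]:
  "topspace (compact_convergence D) = {f. f holomorphic_on D}"
proof (rule subset_antisym)
  show "topspace (compact_convergence D) \<subseteq> {f. f holomorphic_on D}"
    using openin_topspace[of "compact_convergence D"]
    unfolding openin_compact_convergence by blast
  have "openin (compact_convergence D) {f. f holomorphic_on D}"
    unfolding openin_compact_convergence by (auto intro!: exI[of _ "{}"] exI[of _ "1::real"])
  then show "{f. f holomorphic_on D} \<subseteq> topspace (compact_convergence D)"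
    by (rule openin_subset)
qed

lemma openin_compact_convergence_nbhd:
  assumes f: "f holomorphic_on D" and K: "compact K" "K \<subseteq> D"
  shows "openin (compact_convergence D) {g. g holomorphic_on D \<and> (\<forall>z\<in>K. dist (g z) (f z) < e)}"
    (is "openin _ ?N")
  unfolding openin_compact_convergence
proof (intro conjI ballI)
  show "?N \<subseteq> {f. f holomorphic_on D}" by blast
  fix g assume g: "g \<in> ?N"
  have "\<exists>d>0. \<forall>z\<in>K. dist (g z) (f z) + d \<le> e"
  proof (cases "K = {}")
    case True
    then show ?thesis by (auto intro: exI[of _ 1])
  next
    case False
    have "continuous_on K (\<lambda>z. dist (g z) (f z))"
      using f g K by (auto intro!: continuous_on_dist dest!: holomorphic_on_imp_continuous_on
          intro: continuous_on_subset)
    then obtain w where w: "w \<in> K" "\<forall>z\<in>K. dist (g z) (f z) \<le> dist (g w) (f w)"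
      using continuous_attains_sup[OF K(1) False] by blast
    have "dist (g w) (f w) < e" using g w by blast
    then show ?thesis
      using w by (intro exI[of _ "e - dist (g w) (f w)"]) auto
  qed
  then obtain d where d: "d > 0" "\<forall>z\<in>K. dist (g z) (f z) + d \<le> e" by blast
  have "{h. h holomorphic_on D \<and> (\<forall>z\<in>K. dist (h z) (g z) < d)} \<subseteq> ?N"
  proof clarify
    fix h z assume h: "\<forall>z\<in>K. dist (h z) (g z) < d" and z: "z \<in> K"
    have "dist (h z) (f z) \<le> dist (h z) (g z) + dist (g z) (f z)" by (rule dist_triangle)
    also have "\<dots> < d + dist (g z) (f z)" using h z by simp
    also have "\<dots> \<le> e" using d z by (simp add: add.commute)
    finally show "dist (h z) (f z) < e" .
  qed
  then show "\<exists>L d. compact L \<and> L \<subseteq> D \<and> d > 0 \<and>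
      {h. h holomorphic_on D \<and> (\<forall>z\<in>L. dist (h z) (g z) < d)} \<subseteq> ?N"
    using K d by blast
qed

lemma in_closure_of_compact_convergence:
  "f \<in> compact_convergence D closure_of A \<longleftrightarrow> f holomorphic_on D \<and>
     (\<forall>K e. compact K \<and> K \<subseteq> D \<and> e > 0 \<longrightarrow>
        (\<exists>g\<in>A. g holomorphic_on D \<and> (\<forall>z\<in>K. dist (g z) (f z) < e)))"
    (is "?lhs \<longleftrightarrow> ?rhs")
proof
  assume L: ?lhs
  then have f: "f holomorphic_on D" by (auto simp: in_closure_of)
  show ?rhs
  proof (intro conjI allI impI)
    fix K and e :: real assume K: "compact K \<and> K \<subseteq> D \<and> e > 0"
    let ?N = "{g. g holomorphic_on D \<and> (\<forall>z\<in>K. dist (g z) (f z) < e)}"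
    have N: "f \<in> ?N \<and> openin (compact_convergence D) ?N"
      using openin_compact_convergence_nbhd[OF f] f K by simp
    have "\<forall>T. f \<in> T \<and> openin (compact_convergence D) T \<longrightarrow> (\<exists>g. g \<in> A \<and> g \<in> T)"
      using L unfolding in_closure_of by simp
    from mp[OF spec[OF this] N]
    show "\<exists>g\<in>A. g holomorphic_on D \<and> (\<forall>z\<in>K. dist (g z) (f z) < e)" by auto
  qed (rule f)
next
  assume R: ?rhs
  show ?lhs unfolding in_closure_of
  proof (intro conjI allI impI)
    show "f \<in> topspace (compact_convergence D)" using R by simp
    fix T assume T: "f \<in> T \<and> openin (compact_convergence D) T"
    then have "\<exists>K e. compact K \<and> K \<subseteq> D \<and> e > 0 \<and>
        {g. g holomorphic_on D \<and> (\<forall>z\<in>K. dist (g z) (f z) < e)} \<subseteq> T"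
      unfolding openin_compact_convergence by simp
    then obtain K e where K: "compact K \<and> K \<subseteq> D \<and> e > 0"
      and sub: "{g. g holomorphic_on D \<and> (\<forall>z\<in>K. dist (g z) (f z) < e)} \<subseteq> T"
      by (elim exE conjE) simp
    have "\<exists>g\<in>A. g holomorphic_on D \<and> (\<forall>z\<in>K. dist (g z) (f z) < e)"
      using R K by simp
    then show "\<exists>g. g \<in> A \<and> g \<in> T" using sub by auto
  qed
qed

definition closed_convex_hull_C :: "(complex \<Rightarrow> complex) set" where
  "closed_convex_hull_C = compact_convergence unit_disk closure_of (fun_convex hull class_C)"

end

theory Submission
  imports Defs
begin

text \<open>
  Convexity of \<open>f\<close> and Schwarz's lemma give the tangent inequality
  \<open>Re ((f z - f w) / (z f' z)) \<ge> 0\<close> for \<open>\<bar>w\<bar> < \<bar>z\<bar>\<close>. Harnack's inequality for the reciprocal, as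
  \<open>w\<close> tends radially to \<open>z\<close>, gives \<open>Re (z f' z / f z) \<ge> 1/2\<close>, and Jack's lemma turns this into
  \<open>Re (f z / z) > 1/2\<close>. The weak form of the latter condition survives convex combinations and limits.
  It says that the numbers \<open>a (k + 1) * r ^ k\<close> are the Fourier coefficients
  of a probability measure on the circle. With \<open>X = cis (- (m - 1) \<theta>)\<close> and \<open>Y = cis (- (n - 1) \<theta>)\<close>
  the coefficient inequality becomes \<open>\<bar>Cov X Y\<bar> + \<bar>E X * E Y\<bar> \<le> 1\<close>, which follows from
  \<open>2 \<bar>Cov X Y\<bar> \<le> Var X + Var Y = 2 - \<bar>E X\<bar>\<^sup>2 - \<bar>E Y\<bar>\<^sup>2\<close>.
\<close>

section \<open>The Marx-Strohhaecker inequality\<close>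

lemma holomorphic_on_dilation:
  assumes "f holomorphic_on ball 0 1" "norm c \<le> 1"
  shows "(\<lambda>u. f (u * c)) holomorphic_on ball 0 1"
proof -
  have "norm (u * c) < 1" if "norm u < 1" for u
    using assms(2) that mult_left_le[of "norm c" "norm u"] by (simp add: norm_mult)
  then have "(\<lambda>u. u * c) ` ball 0 1 \<subseteq> ball 0 1" by auto
  moreover have "(\<lambda>u. u * c) holomorphic_on ball 0 1" by (intro holomorphic_intros)
  ultimately show ?thesis
    using holomorphic_on_compose_gen[of "\<lambda>u. u * c" "ball 0 1" f "ball 0 1"] assms(1)
    by (simp add: o_def)
qed

text \<open>By the open mapping theorem a nonconstant \<open>q\<close> has open image, so the image
  lies in the interior of the closed right half-plane.\<close>

lemma Re_nonneg_imp_pos_or_constant: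
  assumes hol: "q holomorphic_on ball 0 1" and nonneg: "\<And>z. norm z < 1 \<Longrightarrow> 0 \<le> Re (q z)"
  shows "(\<forall>z\<in>ball 0 1. 0 < Re (q z)) \<or> (\<forall>z\<in>ball 0 1. q z = q 0)"
proof (cases "q constant_on ball 0 1")
  case True
  then show ?thesis by (auto simp: constant_on_def)
next
  case False
  then have op: "open (q ` ball 0 1)"
    using open_mapping_thm[OF hol open_ball connected_ball open_ball subset_refl] by blast
  have sub: "q ` ball 0 1 \<subseteq> {z. 0 \<le> Re z}" using nonneg by auto
  have "interior {z. 0 \<le> Re z} = {z. 0 < Re z}"
    using interior_halfspace_ge[of "1::complex" 0] by (simp add: inner_complex_def)
  then have "q ` ball 0 1 \<subseteq> {z. 0 < Re z}"
    using interior_maximal[OF sub op] by simp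
  then show ?thesis by auto
qed

text \<open>The Cayley-type transform \<open>p\<close> sends the right half-plane to the disk and
  \<open>q 0\<close> to 0, so Schwarz's lemma gives |p z| \<le> |z|. Solving for \<open>q z\<close>
  yields the bound. The transform needs \<open>Re a > 0\<close>, hence the separate constant
  case.\<close>

lemma Harnack_upper_bound:
  assumes hol: "q holomorphic_on ball 0 1" and nonneg: "\<And>z. norm z < 1 \<Longrightarrow> 0 \<le> Re (q z)"
    and z: "norm z < 1"
  shows "(1 - norm z) * Re (q z) \<le> (1 + norm z) * Re (q 0)"
  using Re_nonneg_imp_pos_or_constant[OF hol nonneg]
proof
  assume "\<forall>z\<in>ball 0 1. q z = q 0"
  then have "q 0 = q z" using z by (metis dist_0_norm mem_ball)
  then show ?thesis using nonneg[OF z] by (simp add: mult_right_mono)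
next
  assume pos: "\<forall>z\<in>ball 0 1. 0 < Re (q z)"
  define a where "a = q 0"
  have a: "0 < Re a" using pos by (simp add: a_def)
  define p where "p = (\<lambda>w. (q w - a) / (q w + cnj a))"
  have den: "q w + cnj a \<noteq> 0" if "norm w < 1" for w
  proof -
    have "0 < Re (q w + cnj a)" using pos that a by (simp add: add_pos_pos)
    then show ?thesis by (metis less_irrefl zero_complex.sel(1))
  qed
  have "p holomorphic_on ball 0 1"
    unfolding p_def using den by (intro holomorphic_intros hol) auto
  moreover have "p 0 = 0" by (simp add: p_def a_def)
  moreover have "norm (p w) < 1" if w: "norm w < 1" for w
  proof -
    have "0 < Re (q w)" using pos w by simp
    \<comment> \<open>The squared moduli of \<open>q w + cnj a\<close> and \<open>q w - a\<close>
      differ by four times this product.\<close>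
    then have "0 < Re (q w) * Re a" using a by simp
    then have "(norm (q w - a))\<^sup>2 < (norm (q w + cnj a))\<^sup>2"
      unfolding cmod_power2 by (simp add: power2_eq_square algebra_simps)
    then have "norm (q w - a) < norm (q w + cnj a)" by (rule power2_less_imp_less) simp
    then show ?thesis by (simp add: p_def norm_divide den[OF w] divide_less_eq)
  qed
  ultimately have le: "norm (p z) \<le> norm z" using Schwarz_Lemma(1) z by blast
  \<comment> \<open>The inverse of the transform. Subtracting the imaginary part of \<open>a\<close>
    leaves only the real number \<open>Re a\<close> on the right and does not change the real part
    of \<open>q z\<close>.\<close>
  have eq: "(1 - p z) * (q z - \<i> * Im a) = (1 + p z) * Re a"
  proof -
    have "1 - p z = (a + cnj a) / (q z + cnj a)" "1 + p z = (2 * q z - (a - cnj a)) / (q z + cnj a)"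
      using den[OF z] by (simp_all add: p_def divide_simps)
    moreover have "a + cnj a = 2 * Re a" "2 * q z - (a - cnj a) = 2 * (q z - \<i> * Im a)"
      by (simp_all add: complex_eq_iff)
    ultimately show ?thesis by (simp add: mult_ac)
  qed
  have "(1 - norm z) * Re (q z) \<le> norm (1 - p z) * norm (q z - \<i> * Im a)"
  proof (rule mult_mono)
    have "1 - norm (p z) \<le> norm (1 - p z)" by (metis norm_one norm_triangle_ineq2)
    then show "1 - norm z \<le> norm (1 - p z)" using le by simp
    show "Re (q z) \<le> norm (q z - \<i> * Im a)"
      using complex_Re_le_cmod[of "q z - \<i> * Im a"] by simp
  qed (use nonneg z in auto)
  also have "\<dots> = norm (1 + p z) * Re a"
    using arg_cong[OF eq, of norm] a by (simp add: norm_mult)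
  also have "\<dots> \<le> (1 + norm z) * Re a"
    using a le norm_triangle_ineq[of 1 "p z"] by (intro mult_right_mono) auto
  finally show ?thesis by (simp add: a_def)
qed

section \<open>Convex functions are starlike of order 1/2\<close>

text \<open>Schwarz's lemma, applied to \<open>u \<mapsto> g ((1 - t) * f u + t * f (u * w / z))\<close> with \<open>g\<close> inverse to \<open>f\<close>,
  gives \<open>\<bar>g (f z + t * (f w - f z))\<bar> \<le> \<bar>z\<bar>\<close> for \<open>0 \<le> t \<le> 1\<close>; differentiate at \<open>t = 0\<close>.\<close>

lemma class_C_tangent:
  assumes f: "f \<in> class_C" and z: "norm z < 1" and w: "norm w < norm z"
  shows "0 \<le> Re ((f z - f w) / (z * deriv f z))"
proof -
  have hol: "f holomorphic_on ball 0 1" and inj: "inj_on f (ball 0 1)" and f0: "f 0 = 0"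
    and conv: "convex (f ` ball 0 1)"
    using f by (auto simp: class_C_def class_S_def)
  obtain g where g: "g holomorphic_on f ` ball 0 1"
    and dg: "\<And>z. z \<in> ball 0 1 \<Longrightarrow> deriv f z * deriv g (f z) = 1"
    and gf: "\<And>z. z \<in> ball 0 1 \<Longrightarrow> g (f z) = z"
    using holomorphic_has_inverse[OF hol open_ball inj] by metis
  have opf: "open (f ` ball 0 1)" using open_mapping_thm3[OF hol open_ball inj] .
  have z0: "z \<noteq> 0" using w by auto
  define e where "e = w / z"
  have e: "norm e < 1" using w z0 by (simp add: e_def norm_divide)
  have w_eq: "w = e * z" using z0 by (simp add: e_def)
  have ez: "norm (e * u) < 1" if "norm u < 1" for u
    using e that by (metis mult_strict_mono' norm_ge_zero norm_mult mult_1)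
  have bound: "norm (g (f z + of_real t * (f w - f z))) \<le> norm z" if t: "0 \<le> t" "t \<le> 1" for t
  proof -
    define h where "h = (\<lambda>u. f u + of_real t * (f (e * u) - f u))"
    have him: "h u \<in> f ` ball 0 1" if "norm u < 1" for u
    proof -
      have "h u = (1 - t) *\<^sub>R f u + t *\<^sub>R f (e * u)"
        by (simp add: h_def scaleR_conv_of_real algebra_simps)
      then show ?thesis using conv that ez[OF that] t
        by (auto simp: convex_alt)
    qed
    have fe: "(\<lambda>u. f (e * u)) holomorphic_on ball 0 1"
      using holomorphic_on_dilation[OF hol, of e] e by (simp add: mult.commute)
    have "h holomorphic_on ball 0 1"
      unfolding h_def by (intro holomorphic_intros hol fe)
    then have "(\<lambda>u. g (h u)) holomorphic_on ball 0 1"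
      using holomorphic_on_compose_gen[of h "ball 0 1" g "f ` ball 0 1"] g him
      by (auto simp: o_def image_subset_iff)
    moreover have "g (h 0) = 0" using f0 gf[of 0] by (simp add: h_def)
    moreover have "norm (g (h u)) < 1" if "norm u < 1" for u
      using him[OF that] gf by auto
    ultimately have "norm (g (h z)) \<le> norm z"
      using Schwarz_Lemma(1)[of "\<lambda>u. g (h u)"] z by blast
    then show ?thesis by (simp add: h_def w_eq)
  qed
  define D where "D = (f w - f z) / deriv f z"
  have fz: "f z \<in> f ` ball 0 1" using z by simp
  have "(g has_field_derivative deriv g (f z)) (at (f z + of_real 0 * (f w - f z)))"
    using holomorphic_derivI[OF g opf fz] by simp
  then have gD: "((\<lambda>t. g (f z + of_real t * (f w - f z))) has_vector_derivative ((f w - f z) * deriv g (f z))) (at 0)"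
    by (rule field_vector_diff_chain_at[rotated, unfolded o_def])
      (auto intro!: derivative_eq_intros simp: has_vector_derivative_def scaleR_conv_of_real)
  have "deriv g (f z) = 1 / deriv f z"
    using dg[of z] z by (metis dist_0_norm mem_ball inverse_unique inverse_eq_divide)
  then have "((\<lambda>t. g (f z + of_real t * (f w - f z))) has_vector_derivative D) (at 0)"
    using gD by (simp add: D_def)
  then have R: "((\<lambda>t. Re (cnj z * g (f z + of_real t * (f w - f z)))) has_real_derivative Re (cnj z * D)) (at 0)"
    unfolding has_real_derivative_iff_has_vector_derivative
    by (intro bounded_linear.has_vector_derivative[OF bounded_linear_Re] has_vector_derivative_mult_right)
  \<comment> \<open>At \<open>t = 0\<close> the function in \<open>R\<close> has the value |z|^2,
    which by \<open>bound\<close> is its maximum on [0, 1]. Its derivative there cannot be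
    positive.\<close>
  have "\<not> 0 < Re (cnj z * D)"
  proof
    assume "0 < Re (cnj z * D)"
    from DERIV_pos_inc_right[OF R this] obtain d where d: "d > 0"
      and inc: "\<And>h. 0 < h \<Longrightarrow> h < d \<Longrightarrow> Re (cnj z * g (f z)) < Re (cnj z * g (f z + of_real h * (f w - f z)))"
      by auto
    \<comment> \<open>Below \<open>d\<close>, so that \<open>inc\<close> applies, and at most 1, so
      that \<open>bound\<close> applies.\<close>
    define t where "t = min 1 (d/2)"
    have t: "0 < t" "t < d" "t \<le> 1" using d by (auto simp: t_def)
    have "(norm z)\<^sup>2 = Re (cnj z * g (f z))"
      using gf[of z] z cmod_power2[of z] by (simp add: power2_eq_square)
    also have "\<dots> < Re (cnj z * g (f z + of_real t * (f w - f z)))" using inc t by blast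
    also have "\<dots> \<le> norm z * norm (g (f z + of_real t * (f w - f z)))"
      by (metis complex_Re_le_cmod complex_mod_cnj norm_mult)
    also have "\<dots> \<le> norm z * norm z" using bound[of t] t by (intro mult_left_mono) auto
    finally show False by (simp add: power2_eq_square)
  qed
  moreover have "Re (cnj z * D) = - (norm z)\<^sup>2 * Re ((f z - f w) / (z * deriv f z))"
  proof -
    define X where "X = (f z - f w) / (z * deriv f z)"
    have "cnj z * D = - (cnj z * z) * X"
      using z0 by (simp add: D_def X_def divide_simps) (simp add: algebra_simps)
    also have "\<dots> = of_real (- (norm z)\<^sup>2) * X"
      using complex_norm_square[of z] by (simp add: mult.commute)
    finally show ?thesis unfolding X_def[symmetric] by (simp del: of_real_minus of_real_power)
  qed
  ultimately show ?thesis using z0 by (simp add: mult_less_0_iff zero_le_mult_iff not_less)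
qed

text \<open>The function q u = z f'(z) / (f z - f (u z)) has nonnegative real part by the tangent
  inequality, and its value at 0 is z f'(z) / f z because f 0 = 0. Along real u tending to 1, (1 -
  u) q u tends to 1, while Harnack bounds its real part by (1 + u) Re (q 0), which tends to 2 Re (q
  0).\<close>

lemma class_C_starlike_order_half:
  assumes f: "f \<in> class_C" and z: "norm z < 1" "z \<noteq> 0"
  shows "1 / 2 \<le> Re (z * deriv f z / f z)"
proof -
  have hol: "f holomorphic_on ball 0 1" and inj: "inj_on f (ball 0 1)" and f0: "f 0 = 0"
    using f by (auto simp: class_C_def class_S_def)
  define c where "c = z * deriv f z"
  have c0: "c \<noteq> 0"
    using holomorphic_injective_imp_regular[OF hol open_ball inj, of z] z by (simp add: c_def)
  define q where "q = (\<lambda>u. c / (f z - f (u * z)))"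
  have uz: "norm (u * z) < norm z" if "norm u < 1" for u
    using that z by (simp add: norm_mult)
  have ne: "f z - f (u * z) \<noteq> 0" if "norm u < 1" for u
    using inj_onD[OF inj, of z "u * z"] uz[OF that] z by auto
  have fu: "(\<lambda>u. f (u * z)) holomorphic_on ball 0 1"
    using holomorphic_on_dilation[OF hol] z by simp
  have "q holomorphic_on ball 0 1"
    unfolding q_def using ne by (intro holomorphic_intros fu) auto
  moreover have "0 \<le> Re (q u)" if "norm u < 1" for u
  proof -
    have "0 \<le> Re ((f z - f (u * z)) / c)"
      using class_C_tangent[OF f z(1) uz[OF that]] by (simp add: c_def)
    \<comment> \<open>Inversion preserves the sign of the real part.\<close>
    then have "0 \<le> Re (inverse ((f z - f (u * z)) / c))"
      by (subst inverse_complex.sel(1)) (auto simp only: intro!: divide_nonneg_nonneg add_nonneg_nonneg zero_le_power2)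
    then show ?thesis by (simp add: q_def)
  qed
  ultimately have harnack: "(1 - norm u) * Re (q u) \<le> (1 + norm u) * Re (q 0)" if "norm u < 1" for u
    using Harnack_upper_bound that by blast
  have "(f has_field_derivative deriv f z) (at (1 * z))"
    using holomorphic_derivI[OF hol open_ball, of z] z by simp
  then have "((\<lambda>u. f (u * z)) has_field_derivative deriv f z * z) (at 1)"
    by (rule DERIV_chain2) (auto intro!: derivative_eq_intros)
  \<comment> \<open>Dividing \<open>c\<close> by this difference quotient at a real
    \<open>t < 1\<close> gives \<open>(1 - t) * q t\<close>, so the limit \<open>c\<close> here
    becomes the limit 1 in \<open>l1\<close>.\<close>
  then have lim: "((\<lambda>u. (f (u * z) - f z) / (u - 1)) \<longlongrightarrow> c) (at 1)"
    by (simp add: has_field_derivative_iff c_def mult.commute)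
  have "filterlim complex_of_real (at 1) (at_left 1)"
    unfolding filterlim_at by (auto intro!: tendsto_eq_intros simp: eventually_at_filter)
  from filterlim_compose[OF lim this]
  have "((\<lambda>t. (f (of_real t * z) - f z) / (of_real t - 1)) \<longlongrightarrow> c) (at_left (1::real))" .
  from tendsto_Re[OF tendsto_divide[OF tendsto_const[of c] this c0]]
  have l1: "((\<lambda>t. Re (c / ((f (of_real t * z) - f z) / (of_real t - 1)))) \<longlongrightarrow> 1) (at_left (1::real))"
    using c0 by simp
  have l2: "((\<lambda>t. (1 + t) * Re (q 0)) \<longlongrightarrow> 2 * Re (q 0)) (at_left (1::real))"
    by (auto intro!: tendsto_eq_intros)
  have "\<forall>\<^sub>F t in at_left (1::real). Re (c / ((f (of_real t * z) - f z) / (of_real t - 1))) \<le> (1 + t) * Re (q 0)"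
  proof -
    have "Re (c / ((f (of_real t * z) - f z) / (of_real t - 1))) \<le> (1 + t) * Re (q 0)"
      if t: "0 < t" "t < 1" for t
    proof -
      have "c / ((f (of_real t * z) - f z) / (of_real t - 1)) = of_real (1 - t) * q (of_real t)"
        using ne[of "of_real t"] t by (simp add: q_def divide_simps) (simp add: algebra_simps)
      then show ?thesis using harnack[of "of_real t"] t by (simp del: of_real_diff)
    qed
    then show ?thesis
      using eventually_at_left_real[of 0 "1::real"] by (auto elim!: eventually_mono)
  qed
  from tendsto_le[OF _ l2 l1 this] have "1 \<le> 2 * Re (q 0)" by simp
  then show ?thesis by (simp add: q_def c_def f0)
qed

section \<open>Jack's lemma and the bound for f z / z\<close>

text \<open>On the smallest circle where \<open>\<bar>w\<bar>\<close> reaches \<open>1\<close>, Schwarz's lemma gives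
  \<open>\<bar>w (z0 exp (t s))\<bar> \<le> exp (t * Re s)\<close> for \<open>Re s < 0\<close>; differentiate at \<open>t = 0\<close> in all directions
  \<open>s = -1 + y \<i>\<close>.\<close>

lemma Jack_lemma:
  assumes hol: "w holomorphic_on ball 0 1" and w0: "w 0 = 0"
    and ex: "norm z1 < 1" "1 \<le> norm (w z1)"
  obtains z k where "norm z < 1" "norm (w z) = 1" "1 \<le> k" "z * deriv w z = of_real k * w z"
proof -
  have cont: "continuous_on (ball 0 1) w" using hol holomorphic_on_imp_continuous_on by blast
  \<comment> \<open>A point of \<open>K\<close> of least modulus lies on the smallest circle where
    |w| reaches 1. Restricting to the closed disk through \<open>z1\<close> makes \<open>K\<close>
    compact.\<close>
  define K where "K = cball 0 (norm z1) \<inter> {z. 1 \<le> norm (w z)}"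
  have sub: "cball 0 (norm z1) \<subseteq> ball 0 1" using ex(1) by auto
  have "closed K" unfolding K_def
    using continuous_on_closed_Collect_le[OF continuous_on_const continuous_on_norm[OF continuous_on_subset[OF cont sub]] closed_cball, of 1]
    by (simp add: Int_def)
  then have "compact K" using compact_Int_closed[OF compact_cball[of 0 "norm z1"], of K]
    by (simp add: K_def Int_absorb1)
  moreover have "K \<noteq> {}" using ex by (auto simp: K_def)
  ultimately obtain z where zK: "z \<in> K" and min: "\<And>u. u \<in> K \<Longrightarrow> norm z \<le> norm u"
    using continuous_attains_inf[of K norm] continuous_on_norm_id by blast
  have z1: "norm z < 1" "1 \<le> norm (w z)" and zz1: "norm z \<le> norm z1" using zK ex by (auto simp: K_def)
  have z0: "z \<noteq> 0" using z1 w0 by auto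
  have less: "norm (w u) < 1" if "norm u < norm z" for u
    using min[of u] that zz1 by (force simp: K_def)
  have "(\<lambda>u. w (u * z)) holomorphic_on ball 0 1"
    using holomorphic_on_dilation[OF hol] z1 by simp
  moreover have "norm (w (u * z)) < 1" if "norm u < 1" for u
    using less[of "u * z"] that z0 by (simp add: norm_mult)
  ultimately have schwarz: "norm (w (u * z)) \<le> norm u" if "norm u < 1" for u
    using Schwarz_Lemma(1)[of "\<lambda>u. w (u * z)"] w0 that by auto
  have dz: "(w has_field_derivative deriv w z) (at z)"
    using holomorphic_derivI[OF hol open_ball, of z] z1 by simp
  have "isCont w z" using dz DERIV_isCont by blast
  \<comment> \<open>Membership in \<open>K\<close> gives only 1 \<le> |w z|. Approaching
    \<open>z\<close> radially from inside gives the opposite inequality.\<close>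
  have "filterlim (\<lambda>t. of_real t * z) (nhds z) (at_left (1::real))"
    by (auto intro!: tendsto_eq_intros)
  then have "((\<lambda>t. norm (w (of_real t * z))) \<longlongrightarrow> norm (w z)) (at_left (1::real))"
    using \<open>isCont w z\<close> by (intro tendsto_norm isCont_tendsto_compose[of z w])
  moreover have "\<forall>\<^sub>F t in at_left (1::real). norm (w (of_real t * z)) \<le> 1"
    using eventually_at_left_real[of 0 "1::real"]
  proof (rule eventually_mono)
    fix t :: real assume "t \<in> {0<..<1}"
    then show "norm (w (of_real t * z)) \<le> 1" using schwarz[of "of_real t"] by simp
  qed simp
  ultimately have "norm (w z) \<le> 1" by (rule tendsto_upperbound) simp
  then have wz: "norm (w z) = 1" using z1 by simp
  define k where "k = z * deriv w z / w z"
  have wz0: "w z \<noteq> 0" using wz by auto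
  have k_eq: "k = cnj (w z) * (z * deriv w z)"
  proof -
    have "cnj (w z) * w z = 1" using complex_norm_square[of "w z"] wz by (simp add: mult.commute)
    then show ?thesis using wz0 by (simp add: k_def field_simps)
  qed
  have dir: "1 \<le> Re k + y * Im k" for y
  proof -
    define s where "s = Complex (-1) y"
    \<comment> \<open>This difference vanishes at 0 and is nonpositive for \<open>t > 0\<close> by
      \<open>schwarz\<close>. Its derivative at 0 is Re (s k) + 1 = 1 - Re k - y Im k, which
      therefore is at most 0.\<close>
    define \<phi> where "\<phi> = (\<lambda>t. Re (cnj (w z) * w (exp (of_real t * s) * z)) - exp (- t))"
    have "((\<lambda>x. w (exp x * z)) has_field_derivative deriv w z * (exp 0 * z)) (at (of_real 0 * s))"
      by (rule DERIV_chain2[of w]) (use dz in \<open>auto intro!: derivative_eq_intros\<close>)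
    moreover have "((\<lambda>t. of_real t * s) has_vector_derivative s) (at 0)"
      by (auto intro!: derivative_eq_intros simp: has_vector_derivative_def scaleR_conv_of_real)
    ultimately have "((\<lambda>t. w (exp (of_real t * s) * z)) has_vector_derivative (s * z * deriv w z)) (at 0)"
      using field_vector_diff_chain_at[of "\<lambda>t. of_real t * s" s 0 "\<lambda>x. w (exp x * z)" "deriv w z * (exp 0 * z)"]
      by (simp add: o_def mult_ac)
    then have "((\<lambda>t. Re (cnj (w z) * w (exp (of_real t * s) * z))) has_real_derivative Re (cnj (w z) * (s * z * deriv w z))) (at 0)"
      unfolding has_real_derivative_iff_has_vector_derivative
      by (intro bounded_linear.has_vector_derivative[OF bounded_linear_Re] has_vector_derivative_mult_right)
    moreover have "cnj (w z) * (s * z * deriv w z) = s * k" by (simp add: k_eq)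
    ultimately have "((\<lambda>t. Re (cnj (w z) * w (exp (of_real t * s) * z))) has_real_derivative Re (s * k)) (at 0)"
      by (simp only:)
    moreover have "((\<lambda>t::real. exp (- t)) has_real_derivative - 1) (at 0)"
      by (auto intro!: derivative_eq_intros)
    ultimately have "(\<phi> has_real_derivative (Re (s * k) - - 1)) (at 0)"
      unfolding \<phi>_def by (rule DERIV_diff)
    then have d: "(\<phi> has_real_derivative (Re (s * k) + 1)) (at 0)" by simp
    have "\<phi> t \<le> \<phi> 0" if "0 < t" for t
    proof -
      have "norm (exp (of_real t * s)) = exp (- t)" by (simp add: s_def)
      then have "norm (w (exp (of_real t * s) * z)) \<le> exp (- t)"
        using schwarz[of "exp (of_real t * s)"] that by simp
      then have "Re (cnj (w z) * w (exp (of_real t * s) * z)) \<le> exp (- t)"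
        by (metis complex_Re_le_cmod complex_mod_cnj norm_mult wz mult_1 order_trans)
      moreover have "\<phi> 0 = 0"
        using cmod_power2[of "w z"] wz by (simp add: \<phi>_def power2_eq_square)
      ultimately show ?thesis by (simp add: \<phi>_def)
    qed
    then have "\<not> 0 < Re (s * k) + 1"
      using DERIV_pos_inc_right[OF d] by (metis add_0 dense less_le_not_le)
    then show ?thesis by (simp add: s_def)
  qed
  \<comment> \<open>Otherwise this choice of \<open>y\<close> makes the right side of
    \<open>dir\<close> equal to 0. With \<open>Im k = 0\<close>, taking \<open>y = 0\<close> gives 1
    \<le> Re k.\<close>
  have "Im k = 0"
    using dir[of "- Re k / Im k"] by (cases "Im k = 0") auto
  then have "of_real (Re k) = k" by (simp add: complex_eq_iff)
  then have "z * deriv w z = of_real (Re k) * w z" using wz0 by (simp add: k_def)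
  with that[of z "Re k"] dir[of 0] wz z1 show ?thesis by auto
qed

text \<open>With w = 1 - 1/p, the claim means |w| < 1. If this failed, Jack's lemma would give a
  point u with |w u| = 1, hence Re (p u) = 1/2, and with u p'(u) / p u = k (p u - 1). The real part
  of the latter is -k/2 \<le> -1/2, contrary to \<open>gt\<close>.\<close>

lemma Re_gt_half_if_log_derivative:
  assumes hol: "p holomorphic_on ball 0 1" and p0: "p 0 = 1"
    and ne: "\<And>z. norm z < 1 \<Longrightarrow> p z \<noteq> 0"
    and gt: "\<And>z. norm z < 1 \<Longrightarrow> - 1 / 2 < Re (z * deriv p z / p z)"
    and z: "norm z < 1"
  shows "1 / 2 < Re (p z)"
proof -
  define w where "w = (\<lambda>z. 1 - inverse (p z))"
  have "norm (w z) < 1"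
  proof (rule ccontr)
    assume "\<not> norm (w z) < 1"
    moreover have "w holomorphic_on ball 0 1"
      unfolding w_def using ne by (intro holomorphic_intros hol) auto
    moreover have "w 0 = 0" by (simp add: w_def p0)
    ultimately obtain u k where u: "norm u < 1" "norm (w u) = 1" "1 \<le> k" "u * deriv w u = of_real k * w u"
      using Jack_lemma[of w z] z by (metis not_less)
    have "(p has_field_derivative deriv p u) (at u)"
      using holomorphic_derivI[OF hol open_ball, of u] u by simp
    then have "(w has_field_derivative (deriv p u / (p u)\<^sup>2)) (at u)"
      unfolding w_def using DERIV_diff[OF DERIV_const DERIV_inverse_fun[of p "deriv p u" u UNIV], of 1] ne[OF u(1)]
      by (simp add: power2_eq_square divide_inverse)
    then have "deriv w u = deriv p u / (p u)\<^sup>2" by (rule DERIV_imp_deriv)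
    then have "u * deriv p u / p u = u * deriv w u * p u"
      using ne[OF u(1)] by (simp add: power2_eq_square)
    also have "\<dots> = of_real k * (w u * p u)" using u by simp
    also have "w u * p u = p u - 1" using ne[OF u(1)] by (simp add: w_def algebra_simps)
    finally have "Re (u * deriv p u / p u) = k * (Re (p u) - 1)" by simp
    \<comment> \<open>Since |w u| = 1, the point \<open>p u\<close> is equidistant from 0 and
      1.\<close>
    also have "Re (p u) = 1 / 2"
    proof -
      have "norm (p u - 1) = norm (p u)"
        using arg_cong[OF \<open>w u * p u = p u - 1\<close>, of norm] u(2) by (simp add: norm_mult)
      then have "(norm (p u - 1))\<^sup>2 = (norm (p u))\<^sup>2" by simp
      then show ?thesis unfolding cmod_power2 by (simp add: power2_eq_square algebra_simps)
    qed
    finally show False using gt[OF u(1)] u(3) by simp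
  qed
  have "norm (w z) * norm (p z) < 1 * norm (p z)"
    using \<open>norm (w z) < 1\<close> ne[OF z] by (intro mult_strict_right_mono) auto
  moreover have "w z * p z = p z - 1" using ne[OF z] by (simp add: w_def algebra_simps)
  ultimately have "norm (p z - 1) < norm (p z)" by (metis norm_mult mult_1)
  then have "(norm (p z - 1))\<^sup>2 < (norm (p z))\<^sup>2" by (simp add: power_strict_mono)
  then show ?thesis unfolding cmod_power2 by (simp add: power2_eq_square algebra_simps)
qed

text \<open>For p z = f z / z the logarithmic derivative satisfies z p'(z) / p z = z f'(z) / f z -
  1, so starlikeness of order 1/2 bounds its real part below by -1/2.\<close>

lemma Marx_Strohhaecker:
  assumes f: "f \<in> class_C" and z: "norm z < 1" "z \<noteq> 0"
  shows "1 / 2 < Re (f z / z)"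
proof -
  have hol: "f holomorphic_on ball 0 1" and inj: "inj_on f (ball 0 1)" and f0: "f 0 = 0" and f1: "deriv f 0 = 1"
    using f by (auto simp: class_C_def class_S_def)
  \<comment> \<open>The quotient f u / u with its removable singularity filled in, written in the
    shape that \<open>pole_lemma\<close> expects.\<close>
  define p where "p = (\<lambda>u. if u = 0 then deriv f 0 else (f u - f 0) / (u - 0))"
  have holp: "p holomorphic_on ball 0 1"
    unfolding p_def by (rule pole_lemma[OF hol]) simp
  have p0: "p 0 = 1" by (simp add: p_def f1)
  have pu: "p u = f u / u" if "u \<noteq> 0" for u using that by (simp add: p_def f0)
  have ne: "p u \<noteq> 0" if "norm u < 1" for u
    using inj_onD[OF inj, of u 0] that f0 p0 pu by (cases "u = 0") auto
  have log: "u * deriv p u / p u = u * deriv f u / f u - 1" if u: "norm u < 1" "u \<noteq> 0" for u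
  proof -
    have "(f has_field_derivative deriv f u) (at u)"
      using holomorphic_derivI[OF hol open_ball, of u] u by simp
    then have "((\<lambda>u. f u / u) has_field_derivative ((deriv f u * u - f u) / u\<^sup>2)) (at u)"
      using u by (auto intro!: derivative_eq_intros simp: power2_eq_square)
    moreover have "\<forall>\<^sub>F v in nhds u. p v = f v / v"
      using eventually_nhds_in_open[of "- {0}" u] u by (auto elim!: eventually_mono simp: pu open_Compl)
    ultimately have "deriv p u = (deriv f u * u - f u) / u\<^sup>2"
      using deriv_cong_ev[of p "\<lambda>u. f u / u" u u] DERIV_imp_deriv by simp
    moreover have "f u \<noteq> 0" using ne[OF u(1)] pu u by auto
    ultimately show ?thesis using u by (simp add: pu power2_eq_square field_simps)
  qed
  \<comment> \<open>Rescaled so that the bound -1/2 becomes 0. Since \<open>q 0 = 1\<close>, even a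
    constant \<open>q\<close> has positive real part, so the bound is strict in both cases of the
    open mapping argument.\<close>
  define q where "q = (\<lambda>u. 2 * (u * deriv p u / p u) + 1)"
  have "q holomorphic_on ball 0 1"
    unfolding q_def using ne by (intro holomorphic_intros holp) auto
  moreover have "0 \<le> Re (q u)" if "norm u < 1" for u
  proof (cases "u = 0")
    case False
    have "Re (2 * (c - 1) + 1) = 2 * Re c - 1" for c by simp
    then have "Re (q u) = 2 * Re (u * deriv f u / f u) - 1"
      unfolding q_def log[OF that False] .
    then show ?thesis using class_C_starlike_order_half[OF f that False] by simp
  qed (simp add: q_def)
  moreover have "q 0 = 1" by (simp add: q_def)
  ultimately have q: "0 < Re (q u)" if "norm u < 1" for u
    using Re_nonneg_imp_pos_or_constant[of q] that
    by (metis dist_0_norm mem_ball one_complex.sel(1) zero_less_one)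
  then have "- 1 / 2 < Re (u * deriv p u / p u)" if "norm u < 1" for u
  proof -
    have "Re (2 * c + 1) = 2 * Re c + 1" for c by simp
    from this[of "u * deriv p u / p u"] q[OF that] show ?thesis by (simp add: q_def del: times_complex.sel plus_complex.sel)
  qed
  from Re_gt_half_if_log_derivative[OF holp p0 ne this z(1)] show ?thesis
    using pu[OF z(2)] by simp
qed

section \<open>Coefficients of functions with \<open>Re (f z / z) \<ge> 1/2\<close>\<close>

text \<open>An intermediate class between the closed hull and the coefficient estimate. The weak
  inequality is chosen because it passes directly to limits.\<close>

definition half_plane_class :: "(complex \<Rightarrow> complex) set" where
  "half_plane_class = {f. f holomorphic_on unit_disk \<and> f 0 = 0 \<and> deriv f 0 = 1 \<and>
     (\<forall>z. norm z < 1 \<and> z \<noteq> 0 \<longrightarrow> 1 / 2 \<le> Re (f z / z))}"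

lemma fun_convex_half_plane_class: "fun_convex half_plane_class"
  unfolding fun_convex_def
proof (intro ballI allI impI)
  fix f g and u v :: real
  assume f: "f \<in> half_plane_class" and g: "g \<in> half_plane_class" and uv: "0 \<le> u" "0 \<le> v" "u + v = 1"
  have "1 / 2 \<le> Re ((u *\<^sub>R f z + v *\<^sub>R g z) / z)" if z: "norm z < 1" "z \<noteq> 0" for z
  proof -
    have "1 / 2 = u * (1 / 2) + v * (1 / 2)" using uv by (simp add: field_simps)
    also have "\<dots> \<le> u * Re (f z / z) + v * Re (g z / z)"
      using f g z uv by (intro add_mono mult_left_mono) (auto simp: half_plane_class_def)
    also have "\<dots> = Re ((u *\<^sub>R f z + v *\<^sub>R g z) / z)"
      by (simp only: add_divide_distrib plus_complex.sel scaleR_conv_of_real times_divide_eq_right[symmetric]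
        Re_complex_of_real complex.sel times_complex.sel Im_complex_of_real)
    finally show ?thesis .
  qed
  moreover have "deriv (\<lambda>z. u *\<^sub>R f z + v *\<^sub>R g z) 0 = 1"
  proof (rule DERIV_imp_deriv)
    have "(f has_field_derivative 1) (at 0)" "(g has_field_derivative 1) (at 0)"
      using f g holomorphic_derivI[OF _ open_ball, of _ 0 1 0] by (force simp: half_plane_class_def)+
    then have "((\<lambda>z. u *\<^sub>R f z + v *\<^sub>R g z) has_field_derivative (of_real u * 1 + of_real v * 1)) (at 0)"
      unfolding scaleR_conv_of_real by (intro DERIV_add DERIV_cmult)
    then show "((\<lambda>z. u *\<^sub>R f z + v *\<^sub>R g z) has_field_derivative 1) (at 0)"
      using uv(3) by (metis mult.right_neutral of_real_1 of_real_add)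
  qed
  ultimately show "(\<lambda>z. u *\<^sub>R f z + v *\<^sub>R g z) \<in> half_plane_class"
    using f g by (auto simp: half_plane_class_def scaleR_conv_of_real intro!: holomorphic_intros)
qed

text \<open>The value at 0 and the real-part condition pass to the limit pointwise, using one-point
  compact sets. The derivative at 0 is controlled by Cauchy's inequality.\<close>

lemma closure_of_half_plane_class:
  "compact_convergence unit_disk closure_of half_plane_class \<subseteq> half_plane_class"
proof
  fix f assume "f \<in> compact_convergence unit_disk closure_of half_plane_class"
  then have hol: "f holomorphic_on ball 0 1"
    and approx: "\<And>K e. compact K \<Longrightarrow> K \<subseteq> ball 0 1 \<Longrightarrow> 0 < e \<Longrightarrow>
      \<exists>g\<in>half_plane_class. \<forall>z\<in>K. dist (g z) (f z) < e"
    unfolding in_closure_of_compact_convergence by blast+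
  have point: "\<exists>g\<in>half_plane_class. dist (g z) (f z) < e" if "norm z < 1" "0 < e" for z e
    using approx[of "{z}" e] that by auto
  have "norm (f 0) \<le> 0"
  proof (rule field_le_epsilon)
    fix e :: real assume "0 < e"
    then show "norm (f 0) \<le> 0 + e" using point[of 0 e] by (force simp: half_plane_class_def dist_norm)
  qed
  moreover have "norm (deriv f 0 - 1) \<le> 0"
  proof (rule field_le_epsilon)
    fix e :: real assume e: "0 < e"
    \<comment> \<open>The factor 1/2 offsets the factor 2 from Cauchy's inequality on the circle of
      radius 1/2.\<close>
    obtain g where g: "g \<in> half_plane_class" and dist: "\<And>z. norm z \<le> 1/2 \<Longrightarrow> dist (g z) (f z) < e / 2"
      using approx[of "cball 0 (1/2)" "e / 2"] e by force
    have holg: "g holomorphic_on ball 0 1" and g1: "deriv g 0 = 1" using g by (auto simp: half_plane_class_def)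
    have h: "(\<lambda>z. f z - g z) holomorphic_on ball 0 1" using hol holg by (intro holomorphic_intros)
    have "norm ((deriv ^^ 1) (\<lambda>z. f z - g z) 0) \<le> fact 1 * (e / 2) / (1/2) ^ 1"
    proof (rule Cauchy_inequality)
      show "(\<lambda>z. f z - g z) holomorphic_on ball 0 (1/2)"
        by (rule holomorphic_on_subset[OF h]) auto
      show "continuous_on (cball 0 (1/2)) (\<lambda>z. f z - g z)"
        by (rule continuous_on_subset[OF holomorphic_on_imp_continuous_on[OF h]]) auto
      show "norm (f z - g z) \<le> e / 2" if "norm (0 - z) = 1/2" for z
        using dist[of z] that by (simp add: dist_norm norm_minus_commute)
    qed simp
    moreover have "deriv (\<lambda>z. f z - g z) 0 = deriv f 0 - deriv g 0"
      using hol holg by (intro deriv_diff holomorphic_on_imp_differentiable_at[OF _ open_ball]) auto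
    ultimately show "norm (deriv f 0 - 1) \<le> 0 + e" using g1 by simp
  qed
  moreover have "1 / 2 \<le> Re (f z / z)" if z: "norm z < 1" "z \<noteq> 0" for z
  proof (rule field_le_epsilon)
    fix e :: real assume e: "0 < e"
    \<comment> \<open>The factor \<open>norm z\<close> compensates for the later division by
      \<open>z\<close>.\<close>
    obtain g where g: "g \<in> half_plane_class" "dist (g z) (f z) < e * norm z"
      using point[of z "e * norm z"] e z by auto
    have "Re (g z / z) - Re (f z / z) \<le> norm ((g z - f z) / z)"
      using complex_Re_le_cmod[of "(g z - f z) / z"] by (simp only: diff_divide_distrib minus_complex.sel)
    also have "\<dots> \<le> e" using g z by (simp add: dist_norm norm_divide divide_le_eq)
    finally show "1 / 2 \<le> Re (f z / z) + e" using g(1) z by (force simp: half_plane_class_def)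
  qed
  ultimately show "f \<in> half_plane_class" using hol by (simp add: half_plane_class_def)
qed

section \<open>Taylor coefficients as Fourier coefficients\<close>

text \<open>Cauchy's formula for the k-th derivative on the circle of radius \<open>r\<close>, with
  the parametrisation written out and both sides multiplied by
  \<open>r ^ k / (2 * pi * \<i>)\<close>.\<close>

lemma has_integral_fourier_coeff:
  assumes hol: "f holomorphic_on ball 0 1" and r: "0 < r" "r < 1"
  shows "((\<lambda>t. f (of_real r * cis (2 * pi * t)) * cis (- (2 * pi * real k * t)))
    has_integral (of_real (r ^ k) * taylor_coeff f k)) {0..1}"
proof -
  have "((\<lambda>u. f u / (u - 0) ^ Suc k) has_contour_integral ((2 * pi * \<i>) / fact k * (deriv ^^ k) f 0)) (circlepath 0 r)"
    using r by (intro Cauchy_has_contour_integral_higher_derivative_circlepath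
      continuous_on_subset[OF holomorphic_on_imp_continuous_on[OF hol]] holomorphic_on_subset[OF hol]) auto
  then have J: "((\<lambda>t. f (circlepath 0 r t) / (circlepath 0 r t) ^ Suc k * (2 * pi * \<i> * r * exp (2 * of_real pi * \<i> * t)))
      has_integral ((2 * pi * \<i>) / fact k * (deriv ^^ k) f 0)) {0..1}"
    by (simp add: has_contour_integral vector_derivative_circlepath)
  have val: "of_real (r ^ k) / (2 * pi * \<i>) * ((2 * pi * \<i>) / fact k * (deriv ^^ k) f 0) = of_real (r ^ k) * taylor_coeff f k"
  proof -
    have "x / c * (c / y * z) = x * (z / y)" if "c \<noteq> 0" for x y z c :: complex
      using that by simp
    then show ?thesis unfolding fps_expansion_def fps_nth_Abs_fps by this simp
  qed
  have I: "((\<lambda>t. of_real (r ^ k) / (2 * pi * \<i>) * (f (circlepath 0 r t) / (circlepath 0 r t) ^ Suc k * (2 * pi * \<i> * r * exp (2 * of_real pi * \<i> * t))))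
      has_integral (of_real (r ^ k) * taylor_coeff f k)) {0..1}"
    unfolding val[symmetric] by (intro has_integral_mult_right J)
  show ?thesis
  proof (rule has_integral_eq[OF _ I])
    fix t :: real
    define E where "E = cis (2 * pi * t)"
    have E: "exp (2 * of_real pi * \<i> * t) = E" by (simp add: E_def cis_conv_exp mult_ac)
    have "cis (2 * pi * real k * t) = E ^ k" using Complex.DeMoivre[of "2 * pi * t" k] by (simp add: E_def mult_ac)
    then have C: "cis (- (2 * pi * real k * t)) = 1 / E ^ k" by (metis cis_inverse inverse_eq_divide)
    have E0: "E \<noteq> 0" by (simp add: E_def)
    show "of_real (r ^ k) / (2 * pi * \<i>) * (f (circlepath 0 r t) / (circlepath 0 r t) ^ Suc k * (2 * pi * \<i> * r * exp (2 * of_real pi * \<i> * t)))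
      = f (of_real r * cis (2 * pi * t)) * cis (- (2 * pi * real k * t))"
    proof -
      have *: "x ^ k / c * (y / (x * e) ^ Suc k * (c * x * e)) = y * (1 / e ^ k)"
        if "c \<noteq> 0" "x \<noteq> 0" "e \<noteq> 0" for c x y e :: complex
        using that by (simp add: power_mult_distrib)
      show ?thesis
        unfolding C circlepath E add_0 E_def[symmetric] of_real_power by (rule *) (use r E0 in simp_all)
    qed
  qed
qed

text \<open>Write 2 Re F - 1 = F + cnj F - 1. The term F contributes the stated coefficient. The
  term cnj F contributes only at k = 0, where it cancels the constant -1. The case k = 0 says that
  the weight has total mass 1.\<close>

lemma has_integral_weighted_fourier_coeff:
  assumes f: "f \<in> half_plane_class" and r: "0 < r" "r < 1"
  defines "F \<equiv> \<lambda>t. f (of_real r * cis (2 * pi * t)) / (of_real r * cis (2 * pi * t))"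
  shows "((\<lambda>t. of_real (2 * Re (F t) - 1) * cis (- (2 * pi * real k * t)))
    has_integral (of_real (r ^ k) * taylor_coeff f (Suc k))) {0..1}"
proof -
  have hol: "f holomorphic_on ball 0 1" and f0: "f 0 = 0" and f1: "deriv f 0 = 1"
    using f by (auto simp: half_plane_class_def)
  \<comment> \<open>The k-th Fourier coefficient of the constant 1, shared by \<open>neg\<close> and
    \<open>one\<close>.\<close>
  define \<delta> where "\<delta> = (if k = 0 then 1 else (0::complex))"
  have pos: "((\<lambda>t. F t * cis (- (2 * pi * real k * t))) has_integral (of_real (r ^ k) * taylor_coeff f (Suc k))) {0..1}"
  proof -
    have "((\<lambda>t. 1 / of_real r * (f (of_real r * cis (2 * pi * t)) * cis (- (2 * pi * real (Suc k) * t))))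
        has_integral 1 / of_real r * (of_real (r ^ Suc k) * taylor_coeff f (Suc k))) {0..1}"
      by (intro has_integral_mult_right has_integral_fourier_coeff[OF hol r])
    moreover have "1 / of_real r * (f (of_real r * cis (2 * pi * t)) * cis (- (2 * pi * real (Suc k) * t)))
        = F t * cis (- (2 * pi * real k * t))" for t
    proof -
      have "cis (- (2 * pi * real (Suc k) * t)) = cis (- (2 * pi * real k * t)) / cis (2 * pi * t)"
        by (subst cis_divide, rule arg_cong[of _ _ cis]) (simp add: algebra_simps)
      then show ?thesis by (simp add: F_def)
    qed
    ultimately show ?thesis using r by simp
  qed
  \<comment> \<open>For \<open>k = Suc l\<close> the integrand is, up to a power of
    \<open>r\<close>, the function \<open>f z * z ^ l\<close> on the circle. Its mean is its value
    at 0, which vanishes since \<open>f 0 = 0\<close>.\<close>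
  have "((\<lambda>t. F t * cis (2 * pi * real k * t)) has_integral \<delta>) {0..1}"
  proof (cases k)
    case 0
    then show ?thesis using pos by (simp add: \<delta>_def fps_expansion_def f1)
  next
    case (Suc l)
    have "(\<lambda>z. f z * z ^ l) holomorphic_on ball 0 1" by (intro holomorphic_intros hol)
    from has_integral_fourier_coeff[OF this r, of 0]
    have "((\<lambda>t. f (of_real r * cis (2 * pi * t)) * (of_real r * cis (2 * pi * t)) ^ l) has_integral 0) {0..1}"
      by (simp add: fps_expansion_def f0)
    from has_integral_mult_right[OF this, of "1 / of_real (r ^ Suc l)"]
    have "((\<lambda>t. 1 / of_real (r ^ Suc l) * (f (of_real r * cis (2 * pi * t)) * (of_real r * cis (2 * pi * t)) ^ l)) has_integral 0) {0..1}"
      by simp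
    moreover have "1 / of_real (r ^ Suc l) * (f (of_real r * cis (2 * pi * t)) * (of_real r * cis (2 * pi * t)) ^ l)
        = F t * cis (2 * pi * real k * t)" for t
    proof -
      have "cis (2 * pi * real k * t) = cis (2 * pi * t) ^ Suc l" using Complex.DeMoivre[of "2 * pi * t" k] by (simp add: Suc mult_ac)
      then show ?thesis using r by (simp add: F_def power_mult_distrib)
    qed
    ultimately show ?thesis by (simp add: \<delta>_def Suc)
  qed
  from has_integral_cnj[THEN iffD2, OF this]
  have neg: "((\<lambda>t. cnj (F t) * cis (- (2 * pi * real k * t))) has_integral \<delta>) {0..1}"
    by (simp add: o_def cis_cnj \<delta>_def split: if_splits)
  have "((\<lambda>t. 1 * cis (- (2 * pi * real k * t))) has_integral of_real (r ^ k) * taylor_coeff (\<lambda>_. 1) k) {0..1}"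
    by (rule has_integral_fourier_coeff[OF holomorphic_on_const r])
  then have one: "((\<lambda>t. cis (- (2 * pi * real k * t))) has_integral \<delta>) {0..1}"
    by (simp add: fps_expansion_def \<delta>_def split: if_splits)
  have "of_real (2 * Re (F t) - 1) * c = F t * c + cnj (F t) * c - c" for t c
  proof -
    have "of_real (2 * Re (F t) - 1) = F t + cnj (F t) - 1" by (simp add: complex_add_cnj)
    then show ?thesis by (simp add: algebra_simps)
  qed
  with has_integral_diff[OF has_integral_add[OF pos neg] one] show ?thesis by simp
qed

section \<open>The covariance estimate\<close>

text \<open>\<open>\<bar>E X Y - E X * E Y\<bar> \<le> (Var X + Var Y) / 2\<close> for the unimodular variables
  \<open>X = cis (- j \<theta>)\<close>, \<open>Y = cis (- k \<theta>)\<close>; their variances are \<open>1 - \<bar>E X\<bar>\<^sup>2\<close> and \<open>1 - \<bar>E Y\<bar>\<^sup>2\<close>.\<close>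

lemma coeff_covariance_bound:
  assumes f: "f \<in> half_plane_class" and r: "0 < r" "r < 1"
  defines "A \<equiv> \<lambda>k. of_real (r ^ k) * taylor_coeff f (Suc k)"
  shows "norm (A j * A k - A (j + k)) + norm (A j * A k) \<le> 1"
proof -
  define q where "q t = 2 * Re (f (of_real r * cis (2 * pi * t)) / (of_real r * cis (2 * pi * t))) - 1" for t
  define X where "X k t = cis (- (2 * pi * real k * t))" for k t
  have I: "((\<lambda>t. of_real (q t) * X k t) has_integral A k) {0..1}" for k
    using has_integral_weighted_fourier_coeff[OF f r] unfolding q_def X_def A_def .
  have A0: "A 0 = 1" using f by (simp add: A_def fps_expansion_def half_plane_class_def)
  have q: "0 \<le> q t" for t
  proof -
    have "1 / 2 \<le> Re (f z / z)" if "norm z = r" for z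
      using f r that by (force simp: half_plane_class_def)
    from this[of "of_real r * cis (2 * pi * t)"] show ?thesis using r by (simp add: q_def norm_mult del: Re_divide)
  qed
  have nsq: "cnj x * x = of_real ((norm x)\<^sup>2)" for x :: complex
    using complex_norm_square[of x] by (simp add: mult.commute)
  have "\<exists>s. norm s = 1 \<and> s * d = of_real (norm d)" for d :: complex
  proof (cases "d = 0")
    case False
    have "cnj d / of_real (norm d) * d = of_real (norm d)"
      using False nsq[of d] by (simp add: power2_eq_square)
    moreover have "norm (cnj d / of_real (norm d)) = 1" using False by (simp add: norm_divide)
    ultimately show ?thesis by blast
  qed (auto intro: exI[of _ 1])
  \<comment> \<open>A unimodular factor rotating the covariance onto the nonnegative real
    axis.\<close>
  then obtain s where s: "norm s = 1"
    "s * (A (j + k) - A j * A k) = of_real (norm (A (j + k) - A j * A k))"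
    by blast
  \<comment> \<open>The real part of \<open>W\<close> is q (|X_j - A_j|^2 + |X_k - A_k|^2 - 2 Re (s
    (X_j - A_j) (X_k - A_k))). It is expanded so that \<open>I\<close> integrates each term.\<close>
  define W where "W t = (2 + cnj (A j) * A j + cnj (A k) * A k - 2 * s * A j * A k) * (of_real (q t) * X 0 t)
    - (2 * cnj (A j) - 2 * s * A k) * (of_real (q t) * X j t)
    - (2 * cnj (A k) - 2 * s * A j) * (of_real (q t) * X k t)
    - 2 * s * (of_real (q t) * X (j + k) t)" for t
  have "(W has_integral ((2 + cnj (A j) * A j + cnj (A k) * A k - 2 * s * A j * A k) * A 0
    - (2 * cnj (A j) - 2 * s * A k) * A j - (2 * cnj (A k) - 2 * s * A j) * A k - 2 * s * A (j + k))) {0..1}"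
    unfolding W_def by (intro has_integral_diff has_integral_mult_right I)
  also have "(2 + cnj (A j) * A j + cnj (A k) * A k - 2 * s * A j * A k) * A 0
    - (2 * cnj (A j) - 2 * s * A k) * A j - (2 * cnj (A k) - 2 * s * A j) * A k - 2 * s * A (j + k)
    = 2 - cnj (A j) * A j - cnj (A k) * A k - 2 * (s * (A (j + k) - A j * A k))"
    unfolding A0 by algebra
  also have "\<dots> = of_real (2 - (norm (A j))\<^sup>2 - (norm (A k))\<^sup>2 - 2 * norm (A (j + k) - A j * A k))"
    unfolding s(2) nsq by simp
  finally have "(W has_integral of_real (2 - (norm (A j))\<^sup>2 - (norm (A k))\<^sup>2 - 2 * norm (A (j + k) - A j * A k))) {0..1}" .
  from has_integral_Re[OF this]
  have "((\<lambda>t. Re (W t)) has_integral (2 - (norm (A j))\<^sup>2 - (norm (A k))\<^sup>2 - 2 * norm (A (j + k) - A j * A k))) {0..1}"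
    by (simp only: Re_complex_of_real)
  moreover have "0 \<le> Re (W t)" for t
  proof -
    define u where "u = X j t - A j"
    define v where "v = s * (X k t - A k)"
    have "cnj (X i t) * X i t = 1" for i
      unfolding nsq by (simp add: X_def)
    note unit = this[of j] this[of k]
    have nv: "norm v ^ 2 = norm (X k t - A k) ^ 2" by (simp add: v_def norm_mult s(1))
    have X0: "X 0 t = 1" by (simp add: X_def)
    have jk: "X (j + k) t = X j t * X k t" by (simp add: X_def cis_mult algebra_simps)
    have "Re (W t) = q t * Re ((1 + cnj (A j) * A j - 2 * (cnj (A j) * X j t)) + (1 + cnj (A k) * A k - 2 * (cnj (A k) * X k t)) - 2 * (u * v))"
    proof -
      have "W t = of_real (q t) * ((1 + cnj (A j) * A j - 2 * (cnj (A j) * X j t)) + (1 + cnj (A k) * A k - 2 * (cnj (A k) * X k t)) - 2 * (u * v))"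
        unfolding W_def jk u_def v_def X0 by algebra
      moreover have "Re (of_real x * c) = x * Re c" for x c by simp
      ultimately show ?thesis by (simp only:)
    qed
    also have "\<dots> = q t * ((norm u)\<^sup>2 + (norm v)\<^sup>2 - 2 * Re (u * v))"
    proof -
      have "Re (1 + cnj a * a - 2 * (cnj a * x)) = (norm (x - a))\<^sup>2" if "cnj x * x = 1" for x a
        using arg_cong[OF that, of Re] unfolding cmod_power2 by (simp add: power2_eq_square algebra_simps)
      from this[OF unit(1), of "A j"] this[OF unit(2), of "A k"]
      have "Re (1 + cnj (A j) * A j - 2 * (cnj (A j) * X j t)) = (norm u)\<^sup>2"
        "Re (1 + cnj (A k) * A k - 2 * (cnj (A k) * X k t)) = (norm v)\<^sup>2"
        unfolding nv u_def .
      moreover have "Re (x + y - 2 * c) = Re x + Re y - 2 * Re c" for x y c by simp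
      ultimately show ?thesis by (simp only:)
    qed
    also have "0 \<le> \<dots>"
    proof -
      have "Re (u * v) \<le> norm u * norm v" by (metis complex_Re_le_cmod norm_mult)
      moreover have "0 \<le> (norm u - norm v)\<^sup>2" by simp
      ultimately show ?thesis using q by (intro mult_nonneg_nonneg) (auto simp: power2_diff)
    qed
    finally show ?thesis .
  qed
  ultimately have "0 \<le> 2 - (norm (A j))\<^sup>2 - (norm (A k))\<^sup>2 - 2 * norm (A (j + k) - A j * A k)"
    using has_integral_nonneg by blast
  \<comment> \<open>Replaces |A_j|^2 + |A_k|^2 by the smaller 2 |A_j A_k|; halving then gives the
    claim.\<close>
  moreover have "0 \<le> (norm (A j) - norm (A k))\<^sup>2" by simp
  ultimately show ?thesis by (simp add: power2_diff norm_mult norm_minus_commute)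
qed

text \<open>Every term of the bound on the circle of radius \<open>r\<close> carries the same factor
  \<open>r ^ (j + k)\<close>, which tends to 1 with \<open>r\<close>.\<close>

lemma half_plane_class_coeff_bound:
  assumes f: "f \<in> half_plane_class"
  defines "a \<equiv> taylor_coeff f"
  shows "norm (a (Suc j) * a (Suc k) - a (Suc (j + k))) + norm (a (Suc j) * a (Suc k)) \<le> 1"
    (is "?L \<le> 1")
proof -
  have le: "r ^ (j + k) * ?L \<le> 1" if r: "0 < r" "r < 1" for r :: real
  proof -
    define c :: complex where "c = of_real (r ^ (j + k))"
    have c: "norm c = r ^ (j + k)" using r by (simp add: c_def norm_power)
    have "norm (c * (a (Suc j) * a (Suc k) - a (Suc (j + k)))) + norm (c * (a (Suc j) * a (Suc k))) \<le> 1"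
      using coeff_covariance_bound[OF f r, of j k] by (simp add: a_def c_def power_add algebra_simps)
    then show ?thesis by (simp add: norm_mult c distrib_left)
  qed
  have "((\<lambda>r. r ^ (j + k) * ?L) \<longlongrightarrow> 1 ^ (j + k) * ?L) (at_left 1)"
    by (intro tendsto_intros)
  moreover have "\<forall>\<^sub>F r in at_left 1. r ^ (j + k) * ?L \<le> 1"
    using eventually_at_left_real[of 0 "1::real"] by (rule eventually_mono) (use le in auto)
  ultimately have "1 ^ (j + k) * ?L \<le> 1"
    by (intro tendsto_upperbound[of "\<lambda>r. r ^ (j + k) * ?L"]) auto
  then show ?thesis by simp
qed

section \<open>Extremal functions\<close>

text \<open>The inverse map is w / (1 + x w), so the image of the disk is given by |w| < |1 + x w|.
  As |x| = 1, this is the half-plane Re (x w) > -1/2, which is convex.\<close>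

lemma rotated_half_plane_map_in_class_C:
  assumes x: "norm x = 1"
  shows "(\<lambda>z. z / (1 - x * z)) \<in> class_C"
proof -
  let ?f = "\<lambda>z. z / (1 - x * z)"
  have ne: "1 - x * z \<noteq> 0" if "norm z < 1" for z
    using that x by (metis eq_iff_diff_eq_0 less_irrefl mult_1 norm_mult norm_one)
  have hol: "?f holomorphic_on ball 0 1"
    using ne by (intro holomorphic_intros) auto
  have inj: "inj_on ?f (ball 0 1)"
  proof (rule inj_onI)
    fix z w :: complex assume z: "z \<in> ball 0 1" and w: "w \<in> ball 0 1" and eq: "?f z = ?f w"
    have "z * (1 - x * w) = w * (1 - x * z)"
      using eq ne[of z] ne[of w] z w by (simp add: frac_eq_eq)
    then show "z = w" by (simp add: algebra_simps)
  qed
  have "(?f has_field_derivative 1) (at 0)"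
    by (auto intro!: derivative_eq_intros)
  then have deriv: "deriv ?f 0 = 1" by (rule DERIV_imp_deriv)
  have half: "norm w < norm (1 + x * w) \<longleftrightarrow> - 1 / 2 < inner (cnj x) w" for w
  proof -
    have "norm w < norm (1 + x * w) \<longleftrightarrow> (norm (x * w))\<^sup>2 < (norm (1 + x * w))\<^sup>2"
      using x by (metis mult_1 norm_ge_zero norm_mult power2_less_imp_less power_strict_mono zero_less_numeral)
    also have "\<dots> \<longleftrightarrow> - 1 / 2 < Re (x * w)"
      unfolding cmod_power2 by (simp add: power2_eq_square algebra_simps) linarith
    finally show ?thesis by (simp add: inner_complex_def)
  qed
  have "?f ` ball 0 1 = {w. norm w < norm (1 + x * w)}"
  proof (intro equalityI subsetI)
    fix w assume "w \<in> ?f ` ball 0 1"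
    then obtain z where z: "norm z < 1" and w: "w = ?f z" by auto
    have "1 + x * w = 1 / (1 - x * z)" using ne[OF z] by (simp add: w field_simps)
    then show "w \<in> {w. norm w < norm (1 + x * w)}"
      using z ne[OF z] by (simp add: w norm_divide divide_strict_right_mono)
  next
    fix w assume "w \<in> {w. norm w < norm (1 + x * w)}"
    then have lt: "norm w < norm (1 + x * w)" by simp
    then have nz: "1 + x * w \<noteq> 0" by auto
    have "1 - x * (w / (1 + x * w)) = 1 / (1 + x * w)" using nz by (simp add: field_simps)
    then have "w = ?f (w / (1 + x * w))" using nz by simp
    moreover have "w / (1 + x * w) \<in> ball 0 1"
      using lt nz by (simp add: norm_divide divide_less_eq)
    ultimately show "w \<in> ?f ` ball 0 1" by blast
  qed
  then have "convex (?f ` ball 0 1)"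
    unfolding half using convex_halfspace_gt[of "- 1 / 2" "cnj x"] by simp
  then show ?thesis using hol inj deriv by (simp add: class_C_def class_S_def)
qed

text \<open>The average of N + 1 functions combines the average of the first N, with weight N / (N +
  1), and the last one.\<close>

lemma fun_convex_average:
  assumes F: "fun_convex F" and g: "\<And>i. i < N \<Longrightarrow> g i \<in> F" and N: "0 < N"
  shows "(\<lambda>z. (\<Sum>i<N. g i z) / of_nat N) \<in> F"
  using N g
proof (induction N rule: nat_induct_non_zero)
  case (Suc N)
  let ?u = "real N / real (Suc N)" and ?v = "1 / real (Suc N)"
  have "(\<lambda>z. ?u *\<^sub>R ((\<Sum>i<N. g i z) / of_nat N) + ?v *\<^sub>R g N z) \<in> F"
  proof -
    have "?u + ?v = 1" by (simp add: field_simps)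
    then show ?thesis
      using F[unfolded fun_convex_def, rule_format, of "\<lambda>z. (\<Sum>i<N. g i z) / of_nat N" "g N" ?u ?v] Suc
      by simp
  qed
  moreover have "?u *\<^sub>R (S / of_nat N) + ?v *\<^sub>R y = (S + y) / of_nat (Suc N)" for S y :: complex
    using \<open>0 < N\<close> by (simp add: scaleR_conv_of_real add_divide_distrib del: of_nat_Suc)
  ultimately show ?case by simp
qed simp

lemma one_minus_power_nonzero:
  fixes z :: complex
  assumes "0 < N" "norm z < 1"
  shows "1 - z ^ N \<noteq> 0"
proof
  assume "1 - z ^ N = 0"
  then have "norm z ^ N = 1" by (metis eq_iff_diff_eq_0 norm_one norm_power)
  moreover have "norm z ^ N < 1" using assms by (simp add: power_less_one_iff)
  ultimately show False by simp
qed

text \<open>Multiplied by 1 - z^N = 1 - (\<omega>^k z)^N, each summand becomes z times a finite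
  geometric sum in \<omega>^k z. Summing over k leaves only the constant term of that sum.\<close>

lemma sum_half_plane_maps_roots_of_unity:
  fixes z :: complex
  assumes N: "0 < N" and z: "norm z < 1"
  defines "\<omega> \<equiv> cis (2 * pi / real N)"
  shows "(\<Sum>k<N. z / (1 - \<omega> ^ k * z)) / of_nat N = z / (1 - z ^ N)"
proof -
  have wN: "(\<omega> ^ k) ^ N = 1" for k
  proof -
    have "\<omega> ^ N = 1" using N by (simp add: \<omega>_def Complex.DeMoivre)
    then show ?thesis by (metis mult.commute power_mult power_one)
  qed
  have nw: "norm (\<omega> ^ k * z) < 1" for k using z by (simp add: \<omega>_def norm_mult norm_power)
  then have ne: "1 - \<omega> ^ k * z \<noteq> 0" for k by (metis eq_iff_diff_eq_0 less_irrefl norm_one)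
  have zN: "1 - z ^ N \<noteq> 0"
    using one_minus_power_nonzero[OF N z] .
  \<comment> \<open>For these \<open>i\<close>, \<open>\<omega> ^ i\<close> is an N-th root of unity
    other than 1, so its geometric sum vanishes.\<close>
  have w1: "(\<Sum>k<N. (\<omega> ^ k) ^ i) = 0" if i: "0 < i" "i < N" for i
  proof -
    have "\<omega> ^ i \<noteq> 1"
    proof
      assume "\<omega> ^ i = 1"
      then have "cis (2 * pi * (real i / real N)) = 1" by (simp add: \<omega>_def Complex.DeMoivre mult_ac)
      then have "cos (2 * pi * (real i / real N)) = 1" by (metis cis.sel(1) one_complex.sel(1))
      then obtain n :: int where "2 * pi * (real i / real N) = of_int n * (2 * pi)"
        using cos_one_2pi_int by (metis mult.assoc mult.commute)
      then have "real i = of_int n * real N" using N by (simp add: field_simps)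
      then have "int i = n * int N" by (metis of_int_eq_iff of_int_mult of_int_of_nat_eq)
      then have "int N dvd int i" by simp
      then show False using i by (simp add: nat_dvd_not_less)
    qed
    moreover have "(\<Sum>k<N. (\<omega> ^ i) ^ k) = 0"
      using calculation wN[of i] by (simp add: geometric_sum)
    ultimately show ?thesis by (simp add: power_mult[symmetric] mult.commute)
  qed
  have "z / (1 - \<omega> ^ k * z) * (1 - z ^ N) = z * (\<Sum>i<N. (\<omega> ^ k) ^ i * z ^ i)" for k
  proof -
    have "1 - z ^ N = 1 - (\<omega> ^ k * z) ^ N" by (simp add: power_mult_distrib wN)
    also have "\<dots> = (1 - \<omega> ^ k * z) * (\<Sum>i<N. (\<omega> ^ k * z) ^ i)" by (rule one_diff_power_eq)
    finally show ?thesis using ne[of k] by (simp add: power_mult_distrib)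
  qed
  then have "(\<Sum>k<N. z / (1 - \<omega> ^ k * z)) * (1 - z ^ N) = z * (\<Sum>k<N. \<Sum>i<N. (\<omega> ^ k) ^ i * z ^ i)"
    by (simp add: sum_distrib_right sum_distrib_left)
  also have "(\<Sum>k<N. \<Sum>i<N. (\<omega> ^ k) ^ i * z ^ i) = (\<Sum>i<N. (\<Sum>k<N. (\<omega> ^ k) ^ i) * z ^ i)"
    by (subst sum.swap) (simp add: sum_distrib_right)
  also have "\<dots> = (\<Sum>i<N. if i = 0 then of_nat N else 0)"
    by (rule sum.cong) (auto simp: w1)
  also have "\<dots> = of_nat N" using N by simp
  finally show ?thesis using N zN by (simp add: field_simps)
qed

text \<open>On the disk the function equals the average \<open>h\<close>, which lies in the hull.
  Off the disk the two may differ, so membership is shown in the closure, with \<open>h\<close>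
  itself as the approximation at distance 0.\<close>

lemma roots_of_unity_average_in_closed_convex_hull_C:
  assumes N: "0 < N"
  shows "(\<lambda>z. z / (1 - z ^ N)) \<in> closed_convex_hull_C"
proof -
  define \<omega> where "\<omega> = cis (2 * pi / real N)"
  define h where "h = (\<lambda>z. (\<Sum>k<N. z / (1 - \<omega> ^ k * z)) / of_nat N)"
  have "(\<lambda>z. z / (1 - \<omega> ^ k * z)) \<in> fun_convex hull class_C" for k
    by (intro hull_inc rotated_half_plane_map_in_class_C) (simp add: \<omega>_def norm_power)
  then have h: "h \<in> fun_convex hull class_C"
    unfolding h_def by (intro fun_convex_average[OF fun_convex_fun_convex_hull] N)
  have eq: "h z = z / (1 - z ^ N)" if "z \<in> ball 0 1" for z
    using sum_half_plane_maps_roots_of_unity[OF N] that by (simp add: h_def \<omega>_def)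
  have ne: "1 - z ^ N \<noteq> 0" if "norm z < 1" for z :: complex
    using one_minus_power_nonzero[OF N that] .
  have hol: "(\<lambda>z. z / (1 - z ^ N)) holomorphic_on ball 0 1"
    using ne by (intro holomorphic_intros) auto
  have holh: "h holomorphic_on ball 0 1"
    by (rule holomorphic_transform[OF hol]) (simp add: eq)
  show ?thesis
    unfolding closed_convex_hull_C_def in_closure_of_compact_convergence
    using hol holh h eq by (metis dist_self subsetD)
qed

text \<open>Comparing coefficients in G (1 - X^N) = X gives a recurrence with step N. The guard
  \<open>0 < k\<close> excludes k = 0, where \<open>k - 1\<close> truncates to 0.\<close>

lemma taylor_coeff_roots_of_unity_average:
  assumes N: "0 < N"
  shows "taylor_coeff (\<lambda>z. z / (1 - z ^ N)) k = (if 0 < k \<and> N dvd k - 1 then 1 else 0)"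
proof -
  let ?f = "\<lambda>z::complex. z / (1 - z ^ N)"
  define G where "G = fps_expansion ?f 0"
  have ne: "1 - z ^ N \<noteq> 0" if "norm z < 1" for z :: complex
    using one_minus_power_nonzero[OF N that] .
  have "?f holomorphic_on ball 0 1"
    using ne by (intro holomorphic_intros) auto
  then have "?f has_fps_expansion G"
    unfolding G_def by (intro has_fps_expansion_fps_expansion[of "ball 0 1"]) auto
  then have "(\<lambda>z. ?f z * (1 - z ^ N)) has_fps_expansion G * (1 - fps_X ^ N)"
    by (intro fps_expansion_intros)
  moreover have "\<forall>\<^sub>F z in nhds 0. ?f z * (1 - z ^ N) = z"
    using eventually_nhds_in_open[OF open_ball, of "0::complex" 0 1]
    by (rule eventually_mono) (use ne in simp_all)
  ultimately have "(\<lambda>z. z) has_fps_expansion G * (1 - fps_X ^ N)"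
    by (rule has_fps_expansion_cong[THEN iffD1, rotated 2]) auto
  then have eq: "G * (1 - fps_X ^ N) = fps_X"
    by (rule fps_expansion_unique_complex) (rule has_fps_expansion_fps_X)
  have "fps_nth (G * (1 - fps_X ^ N)) k = fps_nth G k - (if k < N then 0 else fps_nth G (k - N))" for k
    by (simp add: algebra_simps fps_X_power_mult_right_nth)
  then have rec: "fps_nth G k = (if k < N then 0 else fps_nth G (k - N)) + (if k = 1 then 1 else 0)" for k
    unfolding eq fps_X_nth by (simp only: eq_diff_eq add.commute)
  have "fps_nth G k = (if 0 < k \<and> N dvd k - 1 then 1 else 0)"
  proof (induction k rule: less_induct)
    case (less k)
    consider "k < N" | "k = N" | "N < k" by linarith
    then show ?case
    proof cases
      case 1
      then show ?thesis using rec[of k] by (auto dest: dvd_imp_le)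
    next
      case 2
      \<comment> \<open>The recurrence leads to index 0, whose coefficient is 0, so a 1 arises only
        from the extra term at \<open>k = 1\<close>.\<close>
      have "N dvd N - 1 \<longleftrightarrow> N = 1" using N by (auto dest: dvd_imp_le)
      then show ?thesis using rec[of k] rec[of 0] 2 N by auto
    next
      case 3
      have "k - 1 = (k - N - 1) + N" using 3 by simp
      then have "N dvd k - 1 \<longleftrightarrow> N dvd k - N - 1" by (metis dvd_add_left_iff dvd_refl)
      then show ?thesis using rec[of k] less[of "k - N"] 3 N by auto
    qed
  qed
  then show ?thesis by (simp add: G_def)
qed

section \<open>Equivalence of the two inequalities\<close>

text \<open>Both directions rest on c p - q = (p - q) - (1 - c) p. The triangle inequality gives
  one; for the other, c with |1 - c| = 1 is chosen so that the two vectors are aligned and their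
  lengths add.\<close>

lemma norm_diff_add_norm_le_one_iff:
  fixes p q :: complex
  shows "norm (p - q) + norm p \<le> 1 \<longleftrightarrow> (\<forall>c. norm (c * p - q) \<le> max 1 (norm (1 - c)))"
proof
  assume le: "norm (p - q) + norm p \<le> 1"
  show "\<forall>c. norm (c * p - q) \<le> max 1 (norm (1 - c))"
  proof
    fix c :: complex
    let ?M = "max 1 (norm (1 - c))"
    have "norm (c * p - q) = norm ((p - q) - (1 - c) * p)" by (simp add: algebra_simps)
    also have "\<dots> \<le> 1 * norm (p - q) + norm (1 - c) * norm p"
      using norm_triangle_ineq4[of "p - q" "(1 - c) * p"] by (simp add: norm_mult)
    also have "\<dots> \<le> ?M * norm (p - q) + ?M * norm p"
      by (intro add_mono mult_right_mono) auto
    also have "\<dots> = ?M * (norm (p - q) + norm p)" by (simp only: distrib_left)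
    also have "\<dots> \<le> ?M * 1" using le by (intro mult_left_mono) auto
    finally show "norm (c * p - q) \<le> ?M" by simp
  qed
next
  assume all: "\<forall>c. norm (c * p - q) \<le> max 1 (norm (1 - c))"
  show "norm (p - q) + norm p \<le> 1"
  proof (cases "p = 0 \<or> p = q")
    case True
    \<comment> \<open>The value 1 for \<open>c\<close> settles \<open>p = 0\<close>, the value 0
      settles \<open>p = q\<close>.\<close>
    then show ?thesis using all[rule_format, of 1] all[rule_format, of 0] by auto
  next
    case False
    \<comment> \<open>The rotation taking the direction of \<open>p\<close> to that of
      \<open>p - q\<close>.\<close>
    define d where "d = sgn (p - q) / sgn p"
    have d: "norm d = 1" using False by (simp add: d_def norm_divide norm_sgn)
    have sgn: "x = of_real (norm x) * sgn x" for x :: complex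
      by (simp add: sgn_eq)
    have "d * p = of_real (norm p) * sgn (p - q)"
    proof -
      have "d * p = d * (of_real (norm p) * sgn p)" using sgn[of p] by simp
      also have "\<dots> = of_real (norm p) * sgn (p - q)" using False by (simp add: d_def sgn_zero_iff)
      finally show ?thesis .
    qed
    then have "(1 + d) * p - q = of_real (norm (p - q) + norm p) * sgn (p - q)"
      using sgn[of "p - q"] by (simp add: algebra_simps)
    then have "norm ((1 + d) * p - q) = norm (p - q) + norm p"
      using False by (simp add: norm_mult norm_sgn del: of_real_add)
    then show ?thesis using all[rule_format, of "1 + d"] d by simp
  qed
qed

section \<open>Passage to the closed convex hull, and the cases of equality\<close>

lemma closed_convex_hull_C_subset_half_plane_class: "closed_convex_hull_C \<subseteq> half_plane_class"
proof -
  have "class_C \<subseteq> half_plane_class"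
    using Marx_Strohhaecker less_imp_le
    by (auto simp: half_plane_class_def class_C_def class_S_def simp del: Re_divide)
  then have "fun_convex hull class_C \<subseteq> half_plane_class"
    by (rule hull_minimal) (rule fun_convex_half_plane_class)
  then show ?thesis
    unfolding closed_convex_hull_C_def
    by (rule subset_trans[OF closure_of_mono closure_of_half_plane_class])
qed

theorem theorem5:
  fixes m n :: nat
  assumes "m \<ge> 2" and "n \<ge> 2"
  shows
    "(\<forall>f \<in> closed_convex_hull_C. \<forall>a. a = taylor_coeff f \<longrightarrow>
        norm (a m * a n - a (m + n - 1)) + norm (a m * a n) \<le> 1 \<and>
        (\<forall>c. norm (c * a m * a n - a (m + n - 1)) \<le> max 1 (norm (1 - c)))) \<and>
     (\<forall>a :: nat \<Rightarrow> complex.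
        norm (a m * a n - a (m + n - 1)) + norm (a m * a n) \<le> 1 \<longleftrightarrow>
        (\<forall>c. norm (c * a m * a n - a (m + n - 1)) \<le> max 1 (norm (1 - c)))) \<and>
     (\<forall>f a. f = (\<lambda>z. z / (1 - z)) \<and> a = taylor_coeff f \<longrightarrow>
        f \<in> closed_convex_hull_C \<and>
        norm (a m * a n - a (m + n - 1)) + norm (a m * a n) = 1 \<and>
        (\<forall>c. norm (1 - c) \<ge> 1 \<longrightarrow>
           norm (c * a m * a n - a (m + n - 1)) = max 1 (norm (1 - c)))) \<and>
     (\<forall>f a. f = (\<lambda>z. z / (1 - z ^ (m + n - 2))) \<and> a = taylor_coeff f \<longrightarrow>
        f \<in> closed_convex_hull_C \<and>
        norm (a m * a n - a (m + n - 1)) + norm (a m * a n) = 1 \<and>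
        (\<forall>c. norm (1 - c) < 1 \<longrightarrow>
           norm (c * a m * a n - a (m + n - 1)) = max 1 (norm (1 - c))))"
proof -
  let ?N = "m + n - 2"
  have N: "0 < ?N" "Suc ?N = m + n - 1" using assms by auto
  have bound: "norm (a m * a n - a (m + n - 1)) + norm (a m * a n) \<le> 1"
    if "f \<in> closed_convex_hull_C" "a = taylor_coeff f" for f a
  proof -
    have "f \<in> half_plane_class" using that closed_convex_hull_C_subset_half_plane_class by blast
    \<comment> \<open>With these indices \<open>Suc (j + k)\<close> is
      \<open>m + n - 1\<close>.\<close>
    from half_plane_class_coeff_bound[OF this, of "m - 1" "n - 1"] show ?thesis
      using assms that(2) by (simp add: Suc_diff_Suc numeral_2_eq_2)
  qed
  have equiv: "norm (a m * a n - a (m + n - 1)) + norm (a m * a n) \<le> 1 \<longleftrightarrow>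
      (\<forall>c. norm (c * a m * a n - a (m + n - 1)) \<le> max 1 (norm (1 - c)))" for a :: "nat \<Rightarrow> complex"
    using norm_diff_add_norm_le_one_iff[of "a m * a n" "a (m + n - 1)"] by (simp only: mult.assoc)
  have one: "taylor_coeff (\<lambda>z. z / (1 - z)) k = 1" if "0 < k" for k
    using taylor_coeff_roots_of_unity_average[of 1 k] that by simp
  \<comment> \<open>Since \<open>?N\<close> = (m - 1) + (n - 1), one has 0 < m - 1 <
    \<open>?N\<close>, so the m-th coefficient of the second extremal function vanishes.\<close>
  have "\<not> ?N dvd m - 1" using assms by (auto dest: dvd_imp_le)
  then have am: "taylor_coeff (\<lambda>z. z / (1 - z ^ ?N)) m = 0"
    using taylor_coeff_roots_of_unity_average[OF N(1), of m] by simp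
  have amn: "taylor_coeff (\<lambda>z. z / (1 - z ^ ?N)) (m + n - 1) = 1"
    using taylor_coeff_roots_of_unity_average[OF N(1), of "Suc ?N"]
    by (simp only: N(2)[symmetric] diff_Suc_1 dvd_refl zero_less_Suc simp_thms if_True)
  show ?thesis
  proof (intro conjI ballI allI impI; (elim conjE)?)
    fix f a assume "f \<in> closed_convex_hull_C" "a = taylor_coeff f"
    then show le: "norm (a m * a n - a (m + n - 1)) + norm (a m * a n) \<le> 1" by (rule bound)
    show "norm (c * a m * a n - a (m + n - 1)) \<le> max 1 (norm (1 - c))" for c
      using le equiv by blast
  next
    fix a :: "nat \<Rightarrow> complex"
    show "norm (a m * a n - a (m + n - 1)) + norm (a m * a n) \<le> 1 \<longleftrightarrow>
      (\<forall>c. norm (c * a m * a n - a (m + n - 1)) \<le> max 1 (norm (1 - c)))" by (rule equiv)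
  next
    fix f and a :: "nat \<Rightarrow> complex"
    assume f: "f = (\<lambda>z. z / (1 - z))" and a: "a = taylor_coeff f"
    have a1: "a m = 1" "a n = 1" "a (m + n - 1) = 1" using assms one by (auto simp: a f)
    show "f \<in> closed_convex_hull_C"
      using roots_of_unity_average_in_closed_convex_hull_C[of 1] by (simp add: f)
    show "norm (a m * a n - a (m + n - 1)) + norm (a m * a n) = 1" unfolding a1 by simp
    show "norm (c * a m * a n - a (m + n - 1)) = max 1 (norm (1 - c))" if "norm (1 - c) \<ge> 1" for c
      using that unfolding a1 by (simp add: norm_minus_commute)
  next
    fix f and a :: "nat \<Rightarrow> complex"
    assume f: "f = (\<lambda>z. z / (1 - z ^ ?N))" and a: "a = taylor_coeff f"
    have a1: "a m = 0" "a (m + n - 1) = 1"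
      unfolding a f by (rule am, rule amn)
    show "f \<in> closed_convex_hull_C"
      using roots_of_unity_average_in_closed_convex_hull_C[OF N(1)] by (simp add: f)
    show "norm (a m * a n - a (m + n - 1)) + norm (a m * a n) = 1" unfolding a1 by simp
    show "norm (c * a m * a n - a (m + n - 1)) = max 1 (norm (1 - c))" if "norm (1 - c) < 1" for c
      using that unfolding a1 by simp
  qed
qed

end
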